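(* Let $\mathcal{X}$, $\mathcal{Y}$ and $\mathcal{Z}$ be three Hilbert spaces, and let $A\subseteq\mathcal{X}\times\mathcal{Y}$ and $B\subseteq\mathcal{X}\times\mathcal{Z}$ be two range space relations. Then $T=AB^{-1}$ is a range space operator which is a solution of the equation $A=XB$ (that is, $T=AB^{-1}$ is a range space operator and $A=TB$) if and only if $\mathrm{dom}(A)\subseteq\mathrm{dom}(B)$, $\ker(B)\subseteq\ker(A)$ and $\mathrm{mul}(A)=\{0\}$.
   Context: A linear relation in $\mathcal{X}\times\mathcal{Y}$ is a linear subspace $A\subseteq\mathcal{X}\times\mathcal{Y}$. One sets $\mathrm{dom}(A)=\{x:\exists y,\ (x,y)\in A\}$, $\mathrm{ran}(A)=\{y:\exists x,\ (x,y)\in A\}$, $\ker(A)=\{x:(x,0)\in A\}$, $\mathrm{mul}(A)=\{y:(0,y)\in A\}$, and $A^{-1}=\{(y,x):(x,y)\in A\}$. For linear relations $A\subseteq\mathcal{X}\times\mathcal{Y}$ and $B\subseteq\mathcal{Y}\times\mathcal{Z}$, the product is $BA=\{(x,z):\exists y\in\mathcal{Y},\ (x,y)\in A \text{ and } (y,z)\in B\}\subseteq\mathcal{X}\times\mathcal{Z}$. A linear relation $A$ is (the graph of) a linear operator, defined on $\mathrm{dom}(A)$, if and only if $\mathrm{mul}(A)=\{0\}$; linear operators are identified with their graphs. For Hilbert spaces $\mathcal{X},\mathcal{Y}$, a linear relation $A\subseteq\mathcal{X}\times\mathcal{Y}$ is a range space relation if there are a Hilbert space $\mathcal{W}$ and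 a bounded linear operator $F:\mathcal{W}\to\mathcal{X}\times\mathcal{Y}$ (defined on all of $\mathcal{W}$) with $\mathrm{ran}(F)=A$. A range space operator in $\mathcal{X}\times\mathcal{Y}$ is a range space relation that is the graph of a linear operator. *)

theory Defs
  imports Complex_Main "HOL-Algebra.Module"
begin

section \<open>Hilbert spaces over the real or the complex numbers\<close>

text \<open>
  The distribution only has real inner product spaces, and only as a type class. The
  definition of a range space relation quantifies existentially over a Hilbert space, which a
  type class cannot express; so Hilbert spaces are modules (in the sense of HOL-Algebra, i.e.
  with an explicit carrier set) over a scalar field, equipped with an inner product.

  The scalar field is a type of the class below, which has the instances \<^typ>\<open>real\<close> (with the
  identity as conjugation) and \<^typ>\<open>complex\<close>, and up to isomorphism no others (a real normed
  field is isomorphic to one of these two, by the Gelfand-Mazur theorem).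
\<close>

class real_or_complex = real_normed_field +
  fixes conjugate :: "'a \<Rightarrow> 'a"
  assumes conjugate_add: "conjugate (a + b) = conjugate a + conjugate b"
    and conjugate_mult: "conjugate (a * b) = conjugate a * conjugate b"
    and mult_conjugate: "a * conjugate a = (norm a)\<^sup>2 *\<^sub>R 1"

instantiation real :: real_or_complex
begin
definition conjugate_real :: "real \<Rightarrow> real" where "conjugate_real a = a"
instance by standard (simp_all add: conjugate_real_def power2_eq_square)
end

instantiation complex :: real_or_complex
begin
definition conjugate_complex :: "complex \<Rightarrow> complex" where "conjugate_complex = cnj"
instance
  by standard (simp_all add: conjugate_complex_def scaleR_conv_of_real flip: complex_norm_square)
end

text \<open>
  As for every module in HOL-Algebra, the multiplication and the unit that the record inherits
  from rings are irrelevant.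
\<close>

record ('k, 'a) inner_product_space = "('k, 'a) module" +
  ip :: "'a \<Rightarrow> 'a \<Rightarrow> 'k"

definition ip_norm :: "('k::real_or_complex, 'a) inner_product_space \<Rightarrow> 'a \<Rightarrow> real" where
  "ip_norm H x = sqrt (norm (ip H x x))"

definition scalars :: "'k::field ring" where
  "scalars = \<lparr>carrier = UNIV, mult = (*), one = 1, zero = 0, add = (+)\<rparr>"

locale hilbert_space = module scalars H
  for H :: "('k::real_or_complex, 'a) inner_product_space" (structure) +
  assumes ip_add: "\<lbrakk>x \<in> carrier H; y \<in> carrier H; z \<in> carrier H\<rbrakk>
      \<Longrightarrow> ip H (x \<oplus> y) z = ip H x z + ip H y z"
    and ip_smult: "\<lbrakk>x \<in> carrier H; y \<in> carrier H\<rbrakk> \<Longrightarrow> ip H (a \<odot> x) y = a * ip H x y"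
    and ip_commute: "\<lbrakk>x \<in> carrier H; y \<in> carrier H\<rbrakk> \<Longrightarrow> ip H y x = conjugate (ip H x y)"
    and ip_nonneg: "x \<in> carrier H \<Longrightarrow> \<exists>r\<ge>0. ip H x x = of_real r"
    and ip_definite: "\<lbrakk>x \<in> carrier H; ip H x x = 0\<rbrakk> \<Longrightarrow> x = \<zero>"
    and complete: "\<lbrakk>\<forall>n. s n \<in> carrier H;
        \<forall>e>0. \<exists>N. \<forall>m\<ge>N. \<forall>n\<ge>N. ip_norm H (s m \<ominus> s n) < e\<rbrakk>
      \<Longrightarrow> \<exists>l\<in>carrier H. (\<lambda>n. ip_norm H (s n \<ominus> l)) \<longlonglongrightarrow> 0"

definition hilbert_prod ::
    "('k::real_or_complex, 'a) inner_product_space \<Rightarrow> ('k, 'b) inner_product_space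
      \<Rightarrow> ('k, 'a \<times> 'b) inner_product_space" where
  "hilbert_prod X Y =
    \<lparr>carrier = carrier X \<times> carrier Y,
     mult = undefined,
     one = undefined,
     zero = (\<zero>\<^bsub>X\<^esub>, \<zero>\<^bsub>Y\<^esub>),
     add = (\<lambda>(x, y) (x', y'). (x \<oplus>\<^bsub>X\<^esub> x', y \<oplus>\<^bsub>Y\<^esub> y')),
     smult = (\<lambda>a (x, y). (a \<odot>\<^bsub>X\<^esub> x, a \<odot>\<^bsub>Y\<^esub> y)),
     ip = (\<lambda>(x, y) (x', y'). ip X x x' + ip Y y y')\<rparr>"

definition linear_operator ::
    "('k::real_or_complex, 'a) inner_product_space \<Rightarrow> ('k, 'b) inner_product_space
      \<Rightarrow> 'a set \<Rightarrow> ('a \<Rightarrow> 'b) \<Rightarrow> bool" where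
  "linear_operator X Y D f \<longleftrightarrow>
    submodule D scalars X \<and>
    (\<forall>x\<in>D. f x \<in> carrier Y) \<and>
    (\<forall>x\<in>D. \<forall>x'\<in>D. f (x \<oplus>\<^bsub>X\<^esub> x') = f x \<oplus>\<^bsub>Y\<^esub> f x') \<and>
    (\<forall>a. \<forall>x\<in>D. f (a \<odot>\<^bsub>X\<^esub> x) = a \<odot>\<^bsub>Y\<^esub> f x)"

definition bounded_operator ::
    "('k::real_or_complex, 'a) inner_product_space \<Rightarrow> ('k, 'b) inner_product_space
      \<Rightarrow> ('a \<Rightarrow> 'b) \<Rightarrow> bool" where
  "bounded_operator X Y f \<longleftrightarrow>
    linear_operator X Y (carrier X) f \<and>
    (\<exists>C. \<forall>x\<in>carrier X. ip_norm Y (f x) \<le> C * ip_norm X x)"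


section \<open>Linear relations and range space relations\<close>

text \<open>
  The domain, the inverse and the product of relations are \<^const>\<open>Domain\<close>, \<^const>\<open>converse\<close> and
  \<^const>\<open>relcomp\<close>. Note the order in the latter: the product of \<open>A\<close> in \<open>X \<times> Y\<close> and \<open>B\<close> in
  \<open>Y \<times> Z\<close>, in mathematics \<open>BA\<close>, is \<open>A O B\<close>; the abbreviation \<open>B \<circ>\<^sub>r A\<close> restores the usual order.
\<close>

definition linear_relation ::
    "('k::real_or_complex, 'a) inner_product_space \<Rightarrow> ('k, 'b) inner_product_space
      \<Rightarrow> ('a \<times> 'b) set \<Rightarrow> bool" where
  "linear_relation X Y A \<longleftrightarrow> submodule A scalars (hilbert_prod X Y)"

abbreviation rel_product :: "('b \<times> 'c) set \<Rightarrow> ('a \<times> 'b) set \<Rightarrow> ('a \<times> 'c) set"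
    (infixl \<open>\<circ>\<^sub>r\<close> 75) where
  "B \<circ>\<^sub>r A \<equiv> A O B"

definition rel_ker :: "('k, 'b) inner_product_space \<Rightarrow> ('a \<times> 'b) set \<Rightarrow> 'a set" where
  "rel_ker Y A = {x. (x, \<zero>\<^bsub>Y\<^esub>) \<in> A}"

definition rel_mul :: "('k, 'a) inner_product_space \<Rightarrow> ('a \<times> 'b) set \<Rightarrow> 'b set" where
  "rel_mul X A = {y. (\<zero>\<^bsub>X\<^esub>, y) \<in> A}"

text \<open>
  The Hilbert space \<open>W\<close> has its carrier in the type of \<open>X \<times> Y\<close>. This is no restriction: the
  range of a bounded operator on a Hilbert space whose carrier lives in an arbitrary type is a
  range space relation (see \<open>range_space_relationI\<close> below).
\<close>

definition range_space_relation ::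
    "('k::real_or_complex, 'a) inner_product_space \<Rightarrow> ('k, 'b) inner_product_space
      \<Rightarrow> ('a \<times> 'b) set \<Rightarrow> bool" where
  "range_space_relation X Y A \<longleftrightarrow>
    linear_relation X Y A \<and>
    (\<exists>(W :: ('k, 'a \<times> 'b) inner_product_space) F.
      hilbert_space W \<and> bounded_operator W (hilbert_prod X Y) F \<and> F ` carrier W = A)"

definition range_space_operator ::
    "('k::real_or_complex, 'a) inner_product_space \<Rightarrow> ('k, 'b) inner_product_space
      \<Rightarrow> ('a \<times> 'b) set \<Rightarrow> bool" where
  "range_space_operator X Y A \<longleftrightarrow>
    range_space_relation X Y A \<and>
    (\<exists>D f. linear_operator X Y D f \<and> A = {(x, f x) | x. x \<in> D})"

section \<open>Independence of the type of the parametrising Hilbert space\<close>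

lemma scalars_simps [simp]:
  "carrier scalars = UNIV" "mult scalars = (*)" "one scalars = 1" "zero scalars = 0"
  "add scalars = (+)"
  by (simp_all add: scalars_def)

lemma cring_scalars: "cring (scalars :: 'k::field ring)"
proof (rule cringI)
  show "abelian_group (scalars :: 'k ring)"
  proof (rule abelian_groupI)
    fix x :: 'k
    show "\<exists>y\<in>carrier scalars. y \<oplus>\<^bsub>scalars\<^esub> x = \<zero>\<^bsub>scalars\<^esub>"
      by (auto intro: exI[of _ "- x"])
  qed auto
  show "Group.comm_monoid (scalars :: 'k ring)"
    by (rule comm_monoidI) auto
qed (auto simp: algebra_simps)

lemma conjugate_0 [simp]: "conjugate (0 :: 'k::real_or_complex) = 0"
  using conjugate_add[of "0::'k" 0] by simp

lemma mult_conjugate': "a * conjugate a = of_real ((norm (a::'k::real_or_complex))\<^sup>2)"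
  by (simp add: mult_conjugate scaleR_conv_of_real)

lemma conjugate_of_real [simp]: "conjugate (of_real r :: 'k::real_or_complex) = of_real r"
proof (cases "r = 0")
  case False
  have "of_real r * conjugate (of_real r :: 'k) = of_real r * of_real r"
    by (simp add: mult_conjugate' power2_eq_square)
  then show ?thesis using False by simp
qed simp

lemma conjugate_conjugate [simp]: "conjugate (conjugate a) = (a::'k::real_or_complex)"
proof (cases "a = 0")
  case False
  have "conjugate a \<noteq> 0"
    using mult_conjugate'[of a] False by auto
  moreover have "conjugate a * conjugate (conjugate a) = conjugate a * a"
    by (metis conjugate_mult conjugate_of_real mult_conjugate' mult.commute)
  ultimately show ?thesis by simp
qed simp

lemma norm_conjugate [simp]: "norm (conjugate a) = norm (a::'k::real_or_complex)"
proof (cases "a = 0")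
  case False
  have "norm a * norm (conjugate a) = norm a * norm a"
    by (simp add: mult_conjugate' power2_eq_square flip: norm_mult)
  then show ?thesis using False by simp
qed simp

lemma minus_scalars [simp]: "\<ominus>\<^bsub>scalars\<^esub> (a::'k::field) = - a"
  using abelian_group.minus_equality[of "scalars :: 'k ring" "- a" a] cring_scalars[where 'k = 'k]
  by (simp add: cring_def ring_def)

lemma module_diff:
  fixes M :: "('k::field, 'a, 'm) module_scheme"
  assumes "module scalars M" "x \<in> carrier M" "y \<in> carrier M"
  shows "x \<ominus>\<^bsub>M\<^esub> y = x \<oplus>\<^bsub>M\<^esub> (- 1) \<odot>\<^bsub>M\<^esub> y"
  using module.smult_l_minus[OF assms(1), of 1 y] module.smult_one[OF assms(1), of y] assms
  by (simp add: a_minus_def)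

context hilbert_space
begin

lemma smult_in [simp, intro]: "x \<in> carrier H \<Longrightarrow> a \<odot> x \<in> carrier H"
  by (rule smult_closed) auto

lemma diff_conv: "x \<in> carrier H \<Longrightarrow> y \<in> carrier H \<Longrightarrow> x \<ominus> y = x \<oplus> (- 1) \<odot> y"
  by (rule module_diff) (unfold_locales, auto)

lemma ip_add_right:
  assumes "x \<in> carrier H" "y \<in> carrier H" "z \<in> carrier H"
  shows "ip H x (y \<oplus> z) = ip H x y + ip H x z"
  using assms ip_commute[of "y \<oplus> z" x] ip_commute[of y x] ip_commute[of z x]
  by (simp add: ip_add conjugate_add)

lemma ip_smult_right:
  assumes "x \<in> carrier H" "y \<in> carrier H"
  shows "ip H x (a \<odot> y) = conjugate a * ip H x y"
  using assms ip_commute[of "a \<odot> y" x] ip_commute[of y x]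
  by (simp add: ip_smult conjugate_mult)

lemma ip_self: "x \<in> carrier H \<Longrightarrow> ip H x x = of_real ((ip_norm H x)\<^sup>2)"
  using ip_nonneg[of x] by (auto simp: ip_norm_def)

lemma ip_norm_nonneg [simp]: "0 \<le> ip_norm H x"
  by (simp add: ip_norm_def)

lemma ip_norm_zero_imp: "x \<in> carrier H \<Longrightarrow> ip_norm H x = 0 \<Longrightarrow> x = \<zero>"
  using ip_self[of x] ip_definite[of x] by simp

lemma conjugate_minus_1 [simp]: "conjugate (- 1 :: 'k) = - 1"
  using conjugate_of_real[of "- 1", where 'k = 'k] by simp

lemma parallelogram:
  assumes "x \<in> carrier H" "y \<in> carrier H"
  shows "(ip_norm H (x \<oplus> y))\<^sup>2 + (ip_norm H (x \<ominus> y))\<^sup>2 = 2 * (ip_norm H x)\<^sup>2 + 2 * (ip_norm H y)\<^sup>2"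
proof -
  have "(of_real ((ip_norm H (x \<oplus> y))\<^sup>2 + (ip_norm H (x \<ominus> y))\<^sup>2) :: 'k)
      = of_real (2 * (ip_norm H x)\<^sup>2 + 2 * (ip_norm H y)\<^sup>2)"
    using assms
    by (simp only: of_real_add of_real_mult diff_conv flip: ip_self add: a_closed smult_in)
      (simp add: ip_add ip_smult ip_add_right ip_smult_right algebra_simps)
  then show ?thesis by (simp only: of_real_eq_iff)
qed

lemma ip_norm_smult: "x \<in> carrier H \<Longrightarrow> ip_norm H (a \<odot> x) = norm a * ip_norm H x"
  by (simp add: ip_norm_def ip_smult ip_smult_right norm_mult real_sqrt_mult)

lemma ip_norm_project:
  assumes "x \<in> carrier H" "y \<in> carrier H"
  shows "(ip_norm H (of_real ((ip_norm H y)\<^sup>2) \<odot> x \<oplus> (- ip H x y) \<odot> y))\<^sup>2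
    = (ip_norm H y)\<^sup>2 * ((ip_norm H y)\<^sup>2 * (ip_norm H x)\<^sup>2 - (norm (ip H x y))\<^sup>2)" (is "?l = ?r")
proof -
  let ?c = "ip H x y" and ?b = "of_real ((ip_norm H y)\<^sup>2) :: 'k"
  have m: "conjugate (- ?c) = - conjugate ?c"
    using conjugate_mult[of "- 1" ?c] by simp
  have "of_real ?l = (ip H (?b \<odot> x \<oplus> (- ?c) \<odot> y) (?b \<odot> x \<oplus> (- ?c) \<odot> y))"
    using assms by (simp only: flip: ip_self add: a_closed smult_in)
  also have "\<dots> = ?b * (?b * ip H x x - ?c * conjugate ?c)"
    using assms ip_commute[of x y]
    by (simp add: ip_add ip_smult ip_add_right ip_smult_right m ip_self[of y] algebra_simps
        del: of_real_power)
  also have "\<dots> = of_real ?r"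
    using assms by (simp add: mult_conjugate' ip_self)
  finally show ?thesis by (simp only: of_real_eq_iff)
qed

lemma Cauchy_Schwarz:
  assumes "x \<in> carrier H" "y \<in> carrier H"
  shows "norm (ip H x y) \<le> ip_norm H x * ip_norm H y"
proof (cases "ip_norm H y = 0")
  case True
  then have "y = (0::'k) \<odot> y"
    using ip_norm_zero_imp assms smult_r_null[of 0] by simp
  then have "ip H x y = 0"
    using assms ip_smult_right[of x y 0] by simp
  then show ?thesis by simp
next
  case False
  have "0 \<le> (ip_norm H y)\<^sup>2 * ((ip_norm H y)\<^sup>2 * (ip_norm H x)\<^sup>2 - (norm (ip H x y))\<^sup>2)"
    unfolding ip_norm_project[OF assms, symmetric] by simp
  then have "(norm (ip H x y))\<^sup>2 \<le> (ip_norm H x * ip_norm H y)\<^sup>2"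
    using False by (simp add: zero_le_mult_iff power_mult_distrib mult.commute)
  then show ?thesis by (rule power2_le_imp_le) simp
qed

lemma ip_norm_triangle:
  assumes "x \<in> carrier H" "y \<in> carrier H"
  shows "ip_norm H (x \<oplus> y) \<le> ip_norm H x + ip_norm H y"
proof -
  have "(ip_norm H (x \<oplus> y))\<^sup>2 = norm (ip H x x + ip H x y + (ip H y x + ip H y y))"
    using assms by (simp add: ip_norm_def ip_add ip_add_right add_ac)
  also have "\<dots> \<le> norm (ip H x x) + norm (ip H x y) + (norm (ip H y x) + norm (ip H y y))"
    by (meson norm_triangle_le norm_triangle_mono order_refl)
  also have "\<dots> \<le> (ip_norm H x)\<^sup>2 + ip_norm H x * ip_norm H y
      + (ip_norm H y * ip_norm H x + (ip_norm H y)\<^sup>2)"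
    using assms by (intro add_mono Cauchy_Schwarz) (auto simp: ip_norm_def)
  also have "\<dots> = (ip_norm H x + ip_norm H y)\<^sup>2"
    by (simp add: power2_eq_square algebra_simps)
  finally show ?thesis by (rule power2_le_imp_le) simp
qed

lemma diff_add_self:
  assumes "x \<in> carrier H" "y \<in> carrier H"
  shows "x \<oplus> (y \<ominus> x) = y"
proof -
  have "x \<oplus> (y \<oplus> \<ominus> x) = y \<oplus> (x \<oplus> \<ominus> x)"
    using assms a_lcomm by (simp only: a_inv_closed)
  then show ?thesis using assms by (simp add: a_minus_def M.r_neg)
qed

lemma ip_norm_diff_commute:
  assumes "x \<in> carrier H" "y \<in> carrier H"
  shows "ip_norm H (x \<ominus> y) = ip_norm H (y \<ominus> x)"
proof -
  have "y \<ominus> x = (- 1) \<odot> (x \<ominus> y)"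
    using assms
    by (simp add: diff_conv smult_r_distr a_comm flip: smult_assoc1[unfolded scalars_simps])
      (use smult_one in simp)
  then show ?thesis using assms by (simp add: ip_norm_smult)
qed

text \<open>Every coset of the kernel of a bounded operator meets its orthogonal complement.\<close>

lemma orthogonal_representative:
  fixes V :: "('k, 'b) inner_product_space"
  assumes V: "hilbert_space V" and F: "bounded_operator H V F" and w0: "w0 \<in> carrier H"
  shows "\<exists>l\<in>carrier H. F l = F w0 \<and> (\<forall>k\<in>carrier H. F k = \<zero>\<^bsub>V\<^esub> \<longrightarrow> ip H l k = 0)"
proof -
  interpret V: hilbert_space V by fact
  obtain C where C: "\<And>x. x \<in> carrier H \<Longrightarrow> ip_norm V (F x) \<le> C * ip_norm H x"
    and FV: "\<And>x. x \<in> carrier H \<Longrightarrow> F x \<in> carrier V"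
    and Fa: "\<And>x y. x \<in> carrier H \<Longrightarrow> y \<in> carrier H \<Longrightarrow> F (x \<oplus> y) = F x \<oplus>\<^bsub>V\<^esub> F y"
    and Fs: "\<And>a x. x \<in> carrier H \<Longrightarrow> F (a \<odot> x) = a \<odot>\<^bsub>V\<^esub> F x"
    using F unfolding bounded_operator_def linear_operator_def by blast
  define S where "S = {w \<in> carrier H. F w = F w0}"
  define d where "d = (INF w\<in>S. (ip_norm H w)\<^sup>2)"
  have d_le: "d \<le> (ip_norm H w)\<^sup>2" if "w \<in> S" for w
    unfolding d_def using that by (intro cINF_lower bdd_belowI[of _ 0]) auto
  have "\<exists>w\<in>S. (ip_norm H w)\<^sup>2 < d + 1 / real (Suc n)" for n
  proof -
    have "w0 \<in> S" using w0 by (simp add: S_def)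
    moreover have "(INF w\<in>S. (ip_norm H w)\<^sup>2) < d + 1 / real (Suc n)" by (simp add: d_def)
    ultimately show ?thesis
      using cINF_greatest[of S "d + 1 / real (Suc n)" "\<lambda>w. (ip_norm H w)\<^sup>2"] by force
  qed
  then obtain s where s: "\<And>n. s n \<in> S" "\<And>n. (ip_norm H (s n))\<^sup>2 < d + 1 / real (Suc n)"
    by metis
  have sH: "s n \<in> carrier H" for n using s(1) by (auto simp: S_def)
  have half: "(1/2) \<odot>\<^bsub>V\<^esub> v \<oplus>\<^bsub>V\<^esub> (1/2) \<odot>\<^bsub>V\<^esub> v = v" if "v \<in> carrier V" for v
    using V.smult_l_distr[of "1/2" "1/2" v] that V.smult_one[of v] by simp
  have cauchy: "(ip_norm H (s m \<ominus> s n))\<^sup>2 < 2 / real (Suc m) + 2 / real (Suc n)" for m n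
  proof -
    have "(1/2) \<odot> (s m \<oplus> s n) \<in> S"
      using s(1) w0 half[OF FV[OF w0]] by (auto simp: S_def smult_r_distr Fa Fs)
    then have "d \<le> (norm (1/2 :: 'k) * ip_norm H (s m \<oplus> s n))\<^sup>2"
      using d_le sH ip_norm_smult a_closed by metis
    then have "4 * d \<le> (ip_norm H (s m \<oplus> s n))\<^sup>2"
      by (simp add: norm_divide power_mult_distrib power_divide)
    then show ?thesis
      using parallelogram[OF sH[of m] sH[of n]] s(2)[of m] s(2)[of n] by simp
  qed
  have "\<forall>e>0. \<exists>N. \<forall>m\<ge>N. \<forall>n\<ge>N. ip_norm H (s m \<ominus> s n) < e"
  proof (intro allI impI)
    fix e :: real assume e: "e > 0"
    obtain N where N: "4 / e\<^sup>2 < real N" using reals_Archimedean2 by blast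
    have "ip_norm H (s m \<ominus> s n) < e" if "m \<ge> N" "n \<ge> N" for m n
    proof -
      have b: "2 / real (Suc k) \<le> e\<^sup>2 / 2" if "k \<ge> N" for k
      proof -
        have "4 / e\<^sup>2 \<le> real (Suc k)" using N that by simp
        then show ?thesis using e by (simp add: field_simps)
      qed
      have "(ip_norm H (s m \<ominus> s n))\<^sup>2 < e\<^sup>2"
        using cauchy[of m n] b[OF that(1)] b[OF that(2)] by simp
      then show ?thesis by (rule power2_less_imp_less) (use e in simp)
    qed
    then show "\<exists>N. \<forall>m\<ge>N. \<forall>n\<ge>N. ip_norm H (s m \<ominus> s n) < e" by blast
  qed
  then obtain l where l: "l \<in> carrier H" "(\<lambda>n. ip_norm H (s n \<ominus> l)) \<longlonglongrightarrow> 0"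
    using complete[of s] sH by blast
  have "ip_norm V (F w0 \<ominus>\<^bsub>V\<^esub> F l) \<le> C * ip_norm H (s n \<ominus> l)" for n
  proof -
    have "F (s n \<ominus> l) = F (s n) \<ominus>\<^bsub>V\<^esub> F l"
      using sH[of n] l by (simp add: diff_conv V.diff_conv FV Fa Fs)
    then show ?thesis
      using C[of "s n \<ominus> l"] sH[of n] l s(1)[of n] by (simp add: S_def)
  qed
  moreover have "(\<lambda>n. C * ip_norm H (s n \<ominus> l)) \<longlonglongrightarrow> 0"
    using tendsto_mult_left[OF l(2), of C] by simp
  ultimately have "ip_norm V (F w0 \<ominus>\<^bsub>V\<^esub> F l) \<le> 0"
    by (intro LIMSEQ_le_const) auto
  then have "F w0 \<ominus>\<^bsub>V\<^esub> F l = \<zero>\<^bsub>V\<^esub>"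
    using V.ip_norm_zero_imp FV w0 l(1) by (metis V.ip_norm_nonneg V.minus_closed antisym)
  then have Fl: "F l = F w0"
    using V.diff_add_self[of "F l" "F w0"] FV w0 l(1) by simp
  have le: "ip_norm H l \<le> sqrt (d + 1 / real (Suc n)) + ip_norm H (s n \<ominus> l)" for n
  proof -
    have "ip_norm H l \<le> ip_norm H (s n) + ip_norm H (s n \<ominus> l)"
      using ip_norm_triangle[of "s n" "l \<ominus> s n"] diff_add_self[of "s n" l] sH[of n] l(1)
        ip_norm_diff_commute[of l "s n"] by simp
    moreover have "ip_norm H (s n) \<le> sqrt (d + 1 / real (Suc n))"
      by (rule real_le_rsqrt) (use s(2)[of n] in simp)
    ultimately show ?thesis by simp
  qed
  have "(\<lambda>n. sqrt (d + 1 / real (Suc n)) + ip_norm H (s n \<ominus> l)) \<longlonglongrightarrow> sqrt (d + 0) + 0"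
    by (intro tendsto_intros l(2)) (rule LIMSEQ_inverse_real_of_nat[unfolded inverse_eq_divide])
  then have "ip_norm H l \<le> sqrt d"
    using LIMSEQ_le_const le by fastforce
  moreover have "0 \<le> d"
    unfolding d_def using w0 by (intro cINF_greatest) (auto simp: S_def)
  ultimately have l_min: "(ip_norm H l)\<^sup>2 \<le> d"
    using power_mono[of "ip_norm H l" "sqrt d" 2] by simp
  have "ip H l k = 0" if k: "k \<in> carrier H" "F k = \<zero>\<^bsub>V\<^esub>" for k
  proof (cases "ip_norm H k = 0")
    case True
    then show ?thesis using Cauchy_Schwarz[of l k] l(1) k by simp
  next
    case False
    let ?b = "(ip_norm H k)\<^sup>2" and ?c = "- ip H l k"
    have b: "?b > 0" using False by simp
    have "l \<oplus> (?c / of_real ?b) \<odot> k \<in> S"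
      using l(1) k Fl w0 V.smult_r_null FV by (simp add: S_def Fa Fs)
    then have "?b\<^sup>2 * (ip_norm H l)\<^sup>2 \<le> ?b\<^sup>2 * (ip_norm H (l \<oplus> (?c / of_real ?b) \<odot> k))\<^sup>2"
      using l_min d_le by (intro mult_left_mono order.trans[OF l_min]) simp_all
    also have "\<dots> = (ip_norm H (of_real ?b \<odot> (l \<oplus> (?c / of_real ?b) \<odot> k)))\<^sup>2"
      using l(1) k by (simp add: ip_norm_smult power_mult_distrib norm_power)
    also have "of_real ?b \<odot> (l \<oplus> (?c / of_real ?b) \<odot> k) = of_real ?b \<odot> l \<oplus> ?c \<odot> k"
      using l(1) k b by (simp add: smult_r_distr flip: smult_assoc1[unfolded scalars_simps])
    also have "(ip_norm H (of_real ?b \<odot> l \<oplus> ?c \<odot> k))\<^sup>2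
        = ?b * (?b * (ip_norm H l)\<^sup>2 - (norm (ip H l k))\<^sup>2)"
      by (rule ip_norm_project[OF l(1) k(1)])
    finally have "?b * (norm (ip H l k))\<^sup>2 \<le> 0"
      by (simp add: algebra_simps power2_eq_square)
    then have "(norm (ip H l k))\<^sup>2 \<le> 0" using b by (simp add: mult_le_0_iff)
    then show ?thesis by simp
  qed
  with l(1) Fl show ?thesis by blast
qed

end

lemma hilbert_space_hilbert_prod:
  fixes X :: "('k::real_or_complex, 'a) inner_product_space"
    and Y :: "('k, 'b) inner_product_space"
  assumes "hilbert_space X" "hilbert_space Y"
  shows "hilbert_space (hilbert_prod X Y)"
proof -
  interpret X: hilbert_space X by fact
  interpret Y: hilbert_space Y by fact
  let ?P = "hilbert_prod X Y"
  have mod: "module scalars ?P"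
  proof (rule moduleI)
    show "abelian_group ?P"
    proof (rule abelian_groupI)
      fix p assume "p \<in> carrier ?P"
      then show "\<exists>q\<in>carrier ?P. q \<oplus>\<^bsub>?P\<^esub> p = \<zero>\<^bsub>?P\<^esub>"
        by (intro bexI[of _ "(\<ominus>\<^bsub>X\<^esub> fst p, \<ominus>\<^bsub>Y\<^esub> snd p)"])
          (auto simp: hilbert_prod_def X.M.l_neg Y.M.l_neg)
    qed (auto simp: hilbert_prod_def X.a_ac Y.a_ac)
  qed (use X.smult_one Y.smult_one X.smult_assoc1 Y.smult_assoc1 X.smult_l_distr Y.smult_l_distr
        in \<open>auto simp: hilbert_prod_def cring_scalars X.smult_r_distr Y.smult_r_distr\<close>)
  have norm: "(ip_norm ?P (x, y))\<^sup>2 = (ip_norm X x)\<^sup>2 + (ip_norm Y y)\<^sup>2"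
    if "x \<in> carrier X" "y \<in> carrier Y" for x y
  proof -
    have "ip ?P (x, y) (x, y) = of_real ((ip_norm X x)\<^sup>2 + (ip_norm Y y)\<^sup>2)"
      using that by (simp add: hilbert_prod_def X.ip_self Y.ip_self)
    then show ?thesis
      unfolding ip_norm_def[of ?P] by (simp only: norm_of_real) simp
  qed
  have diff: "p \<ominus>\<^bsub>?P\<^esub> q = (fst p \<ominus>\<^bsub>X\<^esub> fst q, snd p \<ominus>\<^bsub>Y\<^esub> snd q)"
    if "p \<in> carrier ?P" "q \<in> carrier ?P" for p q
    using module_diff[OF mod that] that
    by (auto simp: hilbert_prod_def X.diff_conv Y.diff_conv)
  show ?thesis
  proof (intro hilbert_space.intro mod hilbert_space_axioms.intro)
    fix p assume p: "p \<in> carrier ?P"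
    have e: "ip ?P p p = of_real ((ip_norm X (fst p))\<^sup>2 + (ip_norm Y (snd p))\<^sup>2)"
      using p by (auto simp: hilbert_prod_def X.ip_self Y.ip_self)
    then show "\<exists>r\<ge>0. ip ?P p p = of_real r" by (meson add_nonneg_nonneg zero_le_power2)
    assume "ip ?P p p = 0"
    then have "(ip_norm X (fst p))\<^sup>2 + (ip_norm Y (snd p))\<^sup>2 = 0"
      unfolding e of_real_eq_0_iff .
    then show "p = \<zero>\<^bsub>?P\<^esub>"
      using p X.ip_norm_zero_imp Y.ip_norm_zero_imp
      by (auto simp: hilbert_prod_def sum_power2_eq_zero_iff)
  next
    fix s :: "nat \<Rightarrow> 'a \<times> 'b"
    assume s: "\<forall>n. s n \<in> carrier ?P"
      and c: "\<forall>e>0. \<exists>N. \<forall>m\<ge>N. \<forall>n\<ge>N. ip_norm ?P (s m \<ominus>\<^bsub>?P\<^esub> s n) < e"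
    have s': "fst (s n) \<in> carrier X" "snd (s n) \<in> carrier Y" for n
      using s[rule_format, of n] by (auto simp: hilbert_prod_def)
    have le: "ip_norm X (fst (s m) \<ominus>\<^bsub>X\<^esub> fst (s n)) \<le> ip_norm ?P (s m \<ominus>\<^bsub>?P\<^esub> s n)"
      "ip_norm Y (snd (s m) \<ominus>\<^bsub>Y\<^esub> snd (s n)) \<le> ip_norm ?P (s m \<ominus>\<^bsub>?P\<^esub> s n)" for m n
      by (rule power2_le_imp_le; use s s' in \<open>simp add: diff norm\<close>; simp add: ip_norm_def)+
    have "\<exists>l\<in>carrier X. (\<lambda>n. ip_norm X (fst (s n) \<ominus>\<^bsub>X\<^esub> l)) \<longlonglongrightarrow> 0"
      using c le(1) s' by (intro X.complete) (meson le_less_trans)+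
    then obtain x where x: "x \<in> carrier X" "(\<lambda>n. ip_norm X (fst (s n) \<ominus>\<^bsub>X\<^esub> x)) \<longlonglongrightarrow> 0" ..
    have "\<exists>l\<in>carrier Y. (\<lambda>n. ip_norm Y (snd (s n) \<ominus>\<^bsub>Y\<^esub> l)) \<longlonglongrightarrow> 0"
      using c le(2) s' by (intro Y.complete) (meson le_less_trans)+
    then obtain y where y: "y \<in> carrier Y" "(\<lambda>n. ip_norm Y (snd (s n) \<ominus>\<^bsub>Y\<^esub> y)) \<longlonglongrightarrow> 0" ..
    have xy: "(x, y) \<in> carrier ?P" using x y by (simp add: hilbert_prod_def)
    have "ip_norm ?P (s n \<ominus>\<^bsub>?P\<^esub> (x, y))
        = sqrt ((ip_norm X (fst (s n) \<ominus>\<^bsub>X\<^esub> x))\<^sup>2 + (ip_norm Y (snd (s n) \<ominus>\<^bsub>Y\<^esub> y))\<^sup>2)" for n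
    proof -
      have "(ip_norm ?P (s n \<ominus>\<^bsub>?P\<^esub> (x, y)))\<^sup>2
          = (ip_norm X (fst (s n) \<ominus>\<^bsub>X\<^esub> x))\<^sup>2 + (ip_norm Y (snd (s n) \<ominus>\<^bsub>Y\<^esub> y))\<^sup>2"
        using s s' x(1) y(1) xy by (simp add: diff norm)
      moreover have "0 \<le> ip_norm ?P (s n \<ominus>\<^bsub>?P\<^esub> (x, y))" by (simp add: ip_norm_def)
      ultimately show ?thesis by (metis real_sqrt_unique)
    qed
    moreover have "(\<lambda>n. sqrt ((ip_norm X (fst (s n) \<ominus>\<^bsub>X\<^esub> x))\<^sup>2 + (ip_norm Y (snd (s n) \<ominus>\<^bsub>Y\<^esub> y))\<^sup>2))
        \<longlonglongrightarrow> sqrt (0\<^sup>2 + 0\<^sup>2)"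
      by (intro tendsto_intros x y)
    ultimately show "\<exists>l\<in>carrier ?P. (\<lambda>n. ip_norm ?P (s n \<ominus>\<^bsub>?P\<^esub> l)) \<longlonglongrightarrow> 0"
      using xy by (intro bexI[of _ "(x, y)"]) simp_all
  next
    fix p q assume "p \<in> carrier ?P" "q \<in> carrier ?P"
    then show "ip ?P q p = conjugate (ip ?P p q)"
      using X.ip_commute[of "fst p" "fst q"] Y.ip_commute[of "snd p" "snd q"]
      by (auto simp: hilbert_prod_def conjugate_add)
  qed (auto simp: hilbert_prod_def X.ip_add Y.ip_add X.ip_smult Y.ip_smult algebra_simps)
qed

lemma bounded_operator_range:
  fixes W :: "('k::real_or_complex, 'w) inner_product_space"
    and V :: "('k, 'v) inner_product_space"
  assumes "hilbert_space W" "hilbert_space V" and F: "bounded_operator W V F"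
  shows "submodule (F ` carrier W) scalars V"
    and "\<exists>(W' :: ('k, 'v) inner_product_space) G.
      hilbert_space W' \<and> bounded_operator W' V G \<and> G ` carrier W' = F ` carrier W"
proof -
  interpret W: hilbert_space W by fact
  interpret V: hilbert_space V by fact
  obtain C where C: "\<And>x. x \<in> carrier W \<Longrightarrow> ip_norm V (F x) \<le> C * ip_norm W x"
    and FV: "\<And>x. x \<in> carrier W \<Longrightarrow> F x \<in> carrier V"
    and Fa: "\<And>x y. x \<in> carrier W \<Longrightarrow> y \<in> carrier W \<Longrightarrow> F (x \<oplus>\<^bsub>W\<^esub> y) = F x \<oplus>\<^bsub>V\<^esub> F y"
    and Fs: "\<And>a x. x \<in> carrier W \<Longrightarrow> F (a \<odot>\<^bsub>W\<^esub> x) = a \<odot>\<^bsub>V\<^esub> F x"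
    using F unfolding bounded_operator_def linear_operator_def by blast
  have F0: "F \<zero>\<^bsub>W\<^esub> = \<zero>\<^bsub>V\<^esub>"
    using Fs[of "\<zero>\<^bsub>W\<^esub>" 0] W.smult_l_null[of "\<zero>\<^bsub>W\<^esub>"] V.smult_l_null[of "F \<zero>\<^bsub>W\<^esub>"] FV by simp
  define A where "A = F ` carrier W"
  show sub: "submodule (F ` carrier W) scalars V"
  proof (rule V.submoduleI)
    fix a assume "a \<in> F ` carrier W"
    then obtain w where w: "w \<in> carrier W" "a = F w" by blast
    then have "\<ominus>\<^bsub>V\<^esub> a = F ((- 1) \<odot>\<^bsub>W\<^esub> w)"
      using V.smult_l_minus[of 1 a] V.smult_one[of a] FV by (simp add: Fs)
    then show "\<ominus>\<^bsub>V\<^esub> a \<in> F ` carrier W" using w by simp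
  next
    show "\<zero>\<^bsub>V\<^esub> \<in> F ` carrier W" using F0 by (metis W.zero_closed imageI)
  qed (auto simp: FV simp flip: Fa Fs)
  have AV: "A \<subseteq> carrier V" using FV by (auto simp: A_def)
  define M where "M = {w \<in> carrier W. \<forall>k\<in>carrier W. F k = \<zero>\<^bsub>V\<^esub> \<longrightarrow> ip W w k = 0}"
  have M_uniq: "w = w'" if "w \<in> M" "w' \<in> M" "F w = F w'" for w w'
  proof -
    have W: "w \<in> carrier W" "w' \<in> carrier W" using that by (auto simp: M_def)
    have "F (w' \<ominus>\<^bsub>W\<^esub> w) = F w' \<ominus>\<^bsub>V\<^esub> F w"
      using W by (simp add: W.diff_conv V.diff_conv Fa Fs FV)
    also have "\<dots> = \<zero>\<^bsub>V\<^esub>" using that(3) FV W by (simp add: a_minus_def V.M.r_neg)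
    finally have "ip W w' (w' \<ominus>\<^bsub>W\<^esub> w) = 0 \<and> ip W w (w' \<ominus>\<^bsub>W\<^esub> w) = 0"
      using that W by (simp add: M_def)
    then have "ip W (w' \<ominus>\<^bsub>W\<^esub> w) (w' \<ominus>\<^bsub>W\<^esub> w) = 0"
      using W by (simp add: W.diff_conv W.ip_add W.ip_smult)
    then have "w' \<ominus>\<^bsub>W\<^esub> w = \<zero>\<^bsub>W\<^esub>" using W.ip_definite W by simp
    then show ?thesis using W.diff_add_self[of w w'] W by simp
  qed
  have "\<exists>w\<in>M. F w = a" if "a \<in> A" for a
  proof -
    from that obtain w0 where w0: "w0 \<in> carrier W" "a = F w0" by (auto simp: A_def)
    then show ?thesis
      using W.orthogonal_representative[OF assms(2) F w0(1)] by (auto simp: M_def)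
  qed
  then obtain r where r: "\<And>a. a \<in> A \<Longrightarrow> r a \<in> M" "\<And>a. a \<in> A \<Longrightarrow> F (r a) = a" by metis
  have rW: "r a \<in> carrier W" if "a \<in> A" for a using r(1)[OF that] by (simp add: M_def)
  have r_eq: "r a = w" if "w \<in> M" "F w = a" for a w
  proof -
    have "a \<in> A" using that by (auto simp: A_def M_def)
    then show ?thesis using M_uniq r that by metis
  qed
  have A_add: "a \<oplus>\<^bsub>V\<^esub> b \<in> A" if "a \<in> A" "b \<in> A" for a b
    using V.submoduleE(5)[OF sub] that by (simp add: A_def)
  have A_zero: "\<zero>\<^bsub>V\<^esub> \<in> A" using F0 by (metis A_def W.zero_closed imageI)
  have A_smult: "c \<odot>\<^bsub>V\<^esub> a \<in> A" if "a \<in> A" for a c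
    using V.submoduleE(4)[OF sub] that by (simp add: A_def)
  have r_add: "r (a \<oplus>\<^bsub>V\<^esub> b) = r a \<oplus>\<^bsub>W\<^esub> r b" if "a \<in> A" "b \<in> A" for a b
    using that r(1)[of a] r(1)[of b] r(2) by (intro r_eq) (auto simp: M_def Fa W.ip_add)
  have r_smult: "r (c \<odot>\<^bsub>V\<^esub> a) = c \<odot>\<^bsub>W\<^esub> r a" if "a \<in> A" for a c
    using that r(1)[of a] r(2) by (intro r_eq) (auto simp: M_def Fs W.ip_smult)
  define W' where "W' = V\<lparr>carrier := A, ip := \<lambda>a b. ip W (r a) (r b)\<rparr>"
  have W'_simps [simp]: "carrier W' = A" "add W' = add V" "zero W' = zero V" "smult W' = smult V"
    "ip W' = (\<lambda>a b. ip W (r a) (r b))"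
    by (simp_all add: W'_def)
  have norm_W': "ip_norm W' a = ip_norm W (r a)" for a
    by (simp add: ip_norm_def)
  have mod: "module scalars W'"
  proof (rule moduleI)
    show "abelian_group W'"
    proof (rule abelian_groupI)
      fix a assume a: "a \<in> carrier W'"
      show "\<exists>b\<in>carrier W'. b \<oplus>\<^bsub>W'\<^esub> a = \<zero>\<^bsub>W'\<^esub>"
      proof (rule bexI[of _ "\<ominus>\<^bsub>V\<^esub> a"])
        show "\<ominus>\<^bsub>V\<^esub> a \<oplus>\<^bsub>W'\<^esub> a = \<zero>\<^bsub>W'\<^esub>" using V.M.l_neg[of a] AV a by auto
        show "\<ominus>\<^bsub>V\<^esub> a \<in> carrier W'" using V.submoduleE(3)[OF sub, of a] a by (simp add: A_def)
      qed
    qed (use A_add A_zero AV V.a_assoc V.a_comm in \<open>auto simp: subset_iff\<close>)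
  qed (use AV V.smult_one V.smult_assoc1 V.smult_l_distr
        in \<open>auto simp: cring_scalars V.smult_r_distr A_smult subset_iff\<close>)
  have diff: "a \<ominus>\<^bsub>W'\<^esub> b \<in> A \<and> r (a \<ominus>\<^bsub>W'\<^esub> b) = r a \<ominus>\<^bsub>W\<^esub> r b" if "a \<in> A" "b \<in> A" for a b
    using module_diff[OF mod, of a b] that
    by (simp add: A_add A_smult r_add r_smult W.diff_conv rW)
  have "hilbert_space W'"
  proof (intro hilbert_space.intro mod hilbert_space_axioms.intro)
    fix a assume a: "a \<in> carrier W'"
    then show "\<exists>t\<ge>0. ip W' a a = of_real t" using W.ip_nonneg[of "r a"] rW by simp
    assume "ip W' a a = 0"
    then show "a = \<zero>\<^bsub>W'\<^esub>" using W.ip_definite[of "r a"] rW r(2)[of a] a F0 by simp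
  next
    fix s :: "nat \<Rightarrow> 'v"
    assume s: "\<forall>n. s n \<in> carrier W'"
      and c: "\<forall>e>0. \<exists>N. \<forall>m\<ge>N. \<forall>n\<ge>N. ip_norm W' (s m \<ominus>\<^bsub>W'\<^esub> s n) < e"
    have "\<forall>e>0. \<exists>N. \<forall>m\<ge>N. \<forall>n\<ge>N. ip_norm W (r (s m) \<ominus>\<^bsub>W\<^esub> r (s n)) < e"
      using c s by (simp add: norm_W' diff)
    then obtain w where w: "w \<in> carrier W" "(\<lambda>n. ip_norm W (r (s n) \<ominus>\<^bsub>W\<^esub> w)) \<longlonglongrightarrow> 0"
      using W.complete[of "\<lambda>n. r (s n)"] s rW by auto
    have "w \<in> M"
      unfolding M_def
    proof (intro CollectI conjI ballI impI w(1))
      fix k assume k: "k \<in> carrier W" "F k = \<zero>\<^bsub>V\<^esub>"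
      have "norm (ip W w k) \<le> ip_norm W (r (s n) \<ominus>\<^bsub>W\<^esub> w) * ip_norm W k" for n
      proof -
        have sn: "r (s n) \<in> carrier W" "ip W (r (s n)) k = 0"
          using r(1)[of "s n"] s k by (auto simp: M_def)
        then have "ip W (r (s n) \<ominus>\<^bsub>W\<^esub> w) k = - ip W w k"
          using k w by (simp add: W.diff_conv W.ip_add W.ip_smult)
        then show ?thesis
          using W.Cauchy_Schwarz[of "r (s n) \<ominus>\<^bsub>W\<^esub> w" k] sn k w by simp
      qed
      moreover have "(\<lambda>n. ip_norm W (r (s n) \<ominus>\<^bsub>W\<^esub> w) * ip_norm W k) \<longlonglongrightarrow> 0"
        using tendsto_mult_right[OF w(2), of "ip_norm W k"] by simp
      ultimately have "norm (ip W w k) \<le> 0" by (intro LIMSEQ_le_const) auto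
      then show "ip W w k = 0" by simp
    qed
    then have "r (F w) = w" "F w \<in> A" using r_eq w by (auto simp: A_def)
    then have "ip_norm W' (s n \<ominus>\<^bsub>W'\<^esub> F w) = ip_norm W (r (s n) \<ominus>\<^bsub>W\<^esub> w)" for n
      using s by (simp add: norm_W' diff)
    then show "\<exists>l\<in>carrier W'. (\<lambda>n. ip_norm W' (s n \<ominus>\<^bsub>W'\<^esub> l)) \<longlonglongrightarrow> 0"
      using \<open>F w \<in> A\<close> w(2) by (intro bexI[of _ "F w"]) simp_all
  next
    fix a b assume "a \<in> carrier W'" "b \<in> carrier W'"
    then show "ip W' b a = conjugate (ip W' a b)"
      using W.ip_commute[of "r a" "r b"] rW by simp
  qed (auto simp: rW r_add r_smult W.ip_add W.ip_smult)
  moreover have "bounded_operator W' V (\<lambda>a. a)"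
    unfolding bounded_operator_def linear_operator_def
  proof (intro conjI ballI allI exI[of _ C])
    show "submodule (carrier W') scalars W'" by (rule module.carrier_is_submodule[OF mod])
    fix a assume a: "a \<in> carrier W'"
    then show "a \<in> carrier V" using AV by auto
    show "ip_norm V a \<le> C * ip_norm W' a"
      using C[of "r a"] r(2)[of a] rW[of a] a by (simp add: norm_W')
  qed simp_all
  ultimately show "\<exists>(W' :: ('k, 'v) inner_product_space) G.
      hilbert_space W' \<and> bounded_operator W' V G \<and> G ` carrier W' = F ` carrier W"
    by (intro exI[of _ W'] exI[of _ "\<lambda>a. a"]) (simp add: A_def)
qed

lemma range_space_relationI:
  fixes X :: "('k::real_or_complex, 'a) inner_product_space"
    and Y :: "('k, 'b) inner_product_space"
    and W :: "('k, 'w) inner_product_space"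
  assumes "hilbert_space X" "hilbert_space Y" "hilbert_space W"
    and "bounded_operator W (hilbert_prod X Y) F"
  shows "range_space_relation X Y (F ` carrier W)"
  using bounded_operator_range[OF assms(3) hilbert_space_hilbert_prod[OF assms(1,2)] assms(4)]
  by (simp add: range_space_relation_def linear_relation_def)

end

theory Submission
  imports Defs
begin

text \<open>
  If \<open>A\<close> and \<open>B\<close> are the ranges of bounded operators \<open>F\<close> and \<open>G\<close> with components \<open>F\<^sub>X\<close>, \<open>F\<^sub>Y\<close>
  and \<open>G\<^sub>X\<close>, \<open>G\<^sub>Z\<close>, then \<open>AB\<^sup>-\<^sup>1\<close> is the image of the bounded operator
  \<open>(u, v) \<mapsto> (G\<^sub>Z v, F\<^sub>Y u)\<close> on the closed subspace of all \<open>(u, v)\<close> with \<open>F\<^sub>X u = G\<^sub>X v\<close>.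
  So \<open>AB\<^sup>-\<^sup>1\<close> is always a range space relation, and the rest is linear algebra.
\<close>

lemma (in hilbert_space) diff_eq_zero_iff:
  assumes "x \<in> carrier H" "y \<in> carrier H"
  shows "x \<ominus> y = \<zero> \<longleftrightarrow> x = y"
  using diff_add_self[of y x] assms by (auto simp: a_minus_def M.r_neg)

section \<open>Bounded operators\<close>

text \<open>The definition of \<open>bounded_operator\<close> allows a negative constant, but bounds
  can only be multiplied in a composition if one is nonnegative. Raising the constant to
  \<open>max C 0\<close> is harmless because norms are nonnegative.\<close>

lemma bounded_operatorE:
  fixes V :: "('k::real_or_complex, 'a) inner_product_space"
    and W :: "('k, 'b) inner_product_space"
  assumes "bounded_operator V W f"
  obtains C where "C \<ge> 0" "\<And>x. x \<in> carrier V \<Longrightarrow> ip_norm W (f x) \<le> C * ip_norm V x"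
proof -
  obtain C where C: "\<And>x. x \<in> carrier V \<Longrightarrow> ip_norm W (f x) \<le> C * ip_norm V x"
    using assms unfolding bounded_operator_def by blast
  have "ip_norm W (f x) \<le> max C 0 * ip_norm V x" if "x \<in> carrier V" for x
    using C[OF that] mult_right_mono[of C "max C 0" "ip_norm V x"]
    by (simp add: ip_norm_def)
  then show thesis using that[of "max C 0"] by simp
qed

lemma bounded_operatorD:
  assumes "bounded_operator V W f"
  shows "x \<in> carrier V \<Longrightarrow> f x \<in> carrier W"
    and "x \<in> carrier V \<Longrightarrow> y \<in> carrier V \<Longrightarrow> f (x \<oplus>\<^bsub>V\<^esub> y) = f x \<oplus>\<^bsub>W\<^esub> f y"
    and "x \<in> carrier V \<Longrightarrow> f (a \<odot>\<^bsub>V\<^esub> x) = a \<odot>\<^bsub>W\<^esub> f x"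
  using assms by (auto simp: bounded_operator_def linear_operator_def)

lemma bounded_operatorI:
  assumes "hilbert_space V"
    and "\<And>x. x \<in> carrier V \<Longrightarrow> f x \<in> carrier W"
    and "\<And>x y. x \<in> carrier V \<Longrightarrow> y \<in> carrier V \<Longrightarrow> f (x \<oplus>\<^bsub>V\<^esub> y) = f x \<oplus>\<^bsub>W\<^esub> f y"
    and "\<And>a x. x \<in> carrier V \<Longrightarrow> f (a \<odot>\<^bsub>V\<^esub> x) = a \<odot>\<^bsub>W\<^esub> f x"
    and "\<And>x. x \<in> carrier V \<Longrightarrow> ip_norm W (f x) \<le> C * ip_norm V x"
  shows "bounded_operator V W f"
  using assms module.carrier_is_submodule[of scalars V]
  unfolding bounded_operator_def linear_operator_def hilbert_space_def by blast

lemma bounded_operator_comp: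
  assumes V: "hilbert_space V" and f: "bounded_operator V W f" and g: "bounded_operator W U g"
  shows "bounded_operator V U (\<lambda>x. g (f x))"
proof -
  obtain C where C: "C \<ge> 0" "\<And>x. x \<in> carrier V \<Longrightarrow> ip_norm W (f x) \<le> C * ip_norm V x"
    using bounded_operatorE[OF f] by blast
  obtain D where D: "D \<ge> 0" "\<And>x. x \<in> carrier W \<Longrightarrow> ip_norm U (g x) \<le> D * ip_norm W x"
    using bounded_operatorE[OF g] by blast
  show ?thesis
  proof (rule bounded_operatorI[where C = "D * C", OF V])
    fix x assume x: "x \<in> carrier V"
    have "ip_norm U (g (f x)) \<le> D * ip_norm W (f x)"
      using D(2) bounded_operatorD(1)[OF f x] by simp
    also have "\<dots> \<le> D * (C * ip_norm V x)"
      using C(2)[OF x] D(1) by (rule mult_left_mono)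
    finally show "ip_norm U (g (f x)) \<le> D * C * ip_norm V x" by (simp add: mult.assoc)
  qed (simp_all add: bounded_operatorD[OF f] bounded_operatorD[OF g])
qed

text \<open>This turns the condition \<open>f x = g x\<close> into membership in the kernel of one
  bounded operator, to which \<open>hilbert_space_kernel\<close> applies.\<close>

lemma bounded_operator_diff:
  assumes V: "hilbert_space V" and W: "hilbert_space W"
    and f: "bounded_operator V W f" and g: "bounded_operator V W g"
  shows "bounded_operator V W (\<lambda>x. f x \<ominus>\<^bsub>W\<^esub> g x)"
proof -
  interpret W: hilbert_space W by fact
  obtain C where C: "\<And>x. x \<in> carrier V \<Longrightarrow> ip_norm W (f x) \<le> C * ip_norm V x"
    using bounded_operatorE[OF f] by blast
  obtain D where D: "\<And>x. x \<in> carrier V \<Longrightarrow> ip_norm W (g x) \<le> D * ip_norm V x"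
    using bounded_operatorE[OF g] by blast
  note fg = bounded_operatorD[OF f] bounded_operatorD[OF g]
  show ?thesis
  proof (rule bounded_operatorI[where C = "C + D", OF V])
    fix x assume x: "x \<in> carrier V"
    have "ip_norm W (f x \<oplus>\<^bsub>W\<^esub> (- 1) \<odot>\<^bsub>W\<^esub> g x) \<le> ip_norm W (f x) + ip_norm W (g x)"
      using W.ip_norm_triangle[of "f x" "(- 1) \<odot>\<^bsub>W\<^esub> g x"] x by (simp add: fg W.ip_norm_smult)
    then show "ip_norm W (f x \<ominus>\<^bsub>W\<^esub> g x) \<le> (C + D) * ip_norm V x"
      using C[OF x] D[OF x] x by (simp add: fg W.diff_conv algebra_simps)
    fix a
    show "f (a \<odot>\<^bsub>V\<^esub> x) \<ominus>\<^bsub>W\<^esub> g (a \<odot>\<^bsub>V\<^esub> x) = a \<odot>\<^bsub>W\<^esub> (f x \<ominus>\<^bsub>W\<^esub> g x)"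
      using x by (simp add: fg W.diff_conv W.smult_r_distr mult.commute
          flip: W.smult_assoc1[unfolded scalars_simps])
  qed (simp_all add: fg W.diff_conv W.smult_r_distr W.a_ac)
qed

section \<open>Norm, projections and pairing for products of Hilbert spaces\<close>

text \<open>With \<open>fst\<close> and \<open>snd\<close> in place of pattern matching, the rules
  also rewrite elements that are not syntactically pairs, such as values \<open>F u\<close>.\<close>

lemma hilbert_prod_simps:
  "carrier (hilbert_prod X Y) = carrier X \<times> carrier Y"
  "p \<oplus>\<^bsub>hilbert_prod X Y\<^esub> q = (fst p \<oplus>\<^bsub>X\<^esub> fst q, snd p \<oplus>\<^bsub>Y\<^esub> snd q)"
  "a \<odot>\<^bsub>hilbert_prod X Y\<^esub> p = (a \<odot>\<^bsub>X\<^esub> fst p, a \<odot>\<^bsub>Y\<^esub> snd p)"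
  "\<zero>\<^bsub>hilbert_prod X Y\<^esub> = (\<zero>\<^bsub>X\<^esub>, \<zero>\<^bsub>Y\<^esub>)"
  by (simp_all add: hilbert_prod_def split: prod.splits)

lemma ip_norm_hilbert_prod:
  assumes "hilbert_space X" "hilbert_space Y" "x \<in> carrier X" "y \<in> carrier Y"
  shows "ip_norm (hilbert_prod X Y) (x, y) = sqrt ((ip_norm X x)\<^sup>2 + (ip_norm Y y)\<^sup>2)"
proof -
  have "ip (hilbert_prod X Y) (x, y) (x, y) = of_real ((ip_norm X x)\<^sup>2 + (ip_norm Y y)\<^sup>2)"
    using assms by (simp add: hilbert_prod_def hilbert_space.ip_self)
  \<comment> \<open>\<open>norm_of_real\<close> comes first, while \<open>of_real\<close> still
    encloses the whole sum.\<close>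
  then show ?thesis
    unfolding ip_norm_def[of "hilbert_prod X Y"] by (simp only: norm_of_real) simp
qed

lemma bounded_operator_fst:
  assumes X: "hilbert_space X" and Y: "hilbert_space Y"
  shows "bounded_operator (hilbert_prod X Y) X fst"
  by (rule bounded_operatorI[where C = 1, OF hilbert_space_hilbert_prod[OF X Y]])
    (auto simp: hilbert_prod_simps ip_norm_hilbert_prod[OF X Y])

lemma bounded_operator_snd:
  assumes X: "hilbert_space X" and Y: "hilbert_space Y"
  shows "bounded_operator (hilbert_prod X Y) Y snd"
  by (rule bounded_operatorI[where C = 1, OF hilbert_space_hilbert_prod[OF X Y]])
    (auto simp: hilbert_prod_simps ip_norm_hilbert_prod[OF X Y])

lemma bounded_operator_Pair:
  assumes V: "hilbert_space V" and X: "hilbert_space X" and Y: "hilbert_space Y"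
    and f: "bounded_operator V X f" and g: "bounded_operator V Y g"
  shows "bounded_operator V (hilbert_prod X Y) (\<lambda>v. (f v, g v))"
proof -
  obtain C where C: "\<And>v. v \<in> carrier V \<Longrightarrow> ip_norm X (f v) \<le> C * ip_norm V v"
    using bounded_operatorE[OF f] by blast
  obtain D where D: "\<And>v. v \<in> carrier V \<Longrightarrow> ip_norm Y (g v) \<le> D * ip_norm V v"
    using bounded_operatorE[OF g] by blast
  note fg = bounded_operatorD[OF f] bounded_operatorD[OF g]
  show ?thesis
  proof (rule bounded_operatorI[where C = "C + D", OF V])
    fix v assume v: "v \<in> carrier V"
    have "ip_norm (hilbert_prod X Y) (f v, g v) \<le> ip_norm X (f v) + ip_norm Y (g v)"
      using v fg by (simp add: ip_norm_hilbert_prod[OF X Y] sqrt_sum_squares_le_sum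
          hilbert_space.ip_norm_nonneg[OF X] hilbert_space.ip_norm_nonneg[OF Y])
    then show "ip_norm (hilbert_prod X Y) (f v, g v) \<le> (C + D) * ip_norm V v"
      using C[OF v] D[OF v] by (simp add: algebra_simps)
  qed (simp_all add: fg hilbert_prod_simps)
qed

section \<open>The kernel of a bounded operator\<close>

text \<open>A Cauchy sequence in the kernel converges in \<open>H\<close>, and boundedness of
  \<open>F\<close> keeps the limit in the kernel. The other axioms are inherited, as
  \<open>K\<close> changes only the carrier.\<close>

lemma hilbert_space_kernel:
  fixes H :: "('k::real_or_complex, 'a) inner_product_space"
    and V :: "('k, 'b) inner_product_space"
  assumes H: "hilbert_space H" and V: "hilbert_space V" and F: "bounded_operator H V F"
  defines "K \<equiv> H\<lparr>carrier := {w \<in> carrier H. F w = \<zero>\<^bsub>V\<^esub>}\<rparr>"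
  shows "hilbert_space K" and "bounded_operator K H (\<lambda>w. w)"
proof -
  interpret H: hilbert_space H by fact
  interpret V: hilbert_space V by fact
  note F_simps = bounded_operatorD[OF F]
  obtain C where C: "\<And>x. x \<in> carrier H \<Longrightarrow> ip_norm V (F x) \<le> C * ip_norm H x"
    using bounded_operatorE[OF F] by blast
  have K_simps [simp]: "w \<in> carrier K \<longleftrightarrow> w \<in> carrier H \<and> F w = \<zero>\<^bsub>V\<^esub>"
    "add K = add H" "zero K = zero H" "smult K = smult H" "ip K = ip H" for w
    by (auto simp: K_def)
  have F0: "F \<zero>\<^bsub>H\<^esub> = \<zero>\<^bsub>V\<^esub>"
    using F_simps(3)[of "\<zero>\<^bsub>H\<^esub>" 0] H.smult_l_null[of "\<zero>\<^bsub>H\<^esub>"]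
      V.smult_l_null[of "F \<zero>\<^bsub>H\<^esub>"] F_simps(1) by simp
  have V0: "a \<odot>\<^bsub>V\<^esub> \<zero>\<^bsub>V\<^esub> = \<zero>\<^bsub>V\<^esub>" for a
    using V.smult_r_null by simp
  have norm_K: "ip_norm K w = ip_norm H w" for w by (simp add: ip_norm_def)
  have mod: "module scalars K"
  proof (rule moduleI)
    show "abelian_group K"
    proof (rule abelian_groupI)
      fix w assume w: "w \<in> carrier K"
      \<comment> \<open>Written as a multiple of \<open>w\<close>, the inverse is seen to lie in the
        kernel by homogeneity of \<open>F\<close>.\<close>
      have "(- 1) \<odot>\<^bsub>H\<^esub> w = \<ominus>\<^bsub>H\<^esub> w"
        using w H.smult_l_minus[of 1 w] H.smult_one[of w] by simp
      then have "(- 1) \<odot>\<^bsub>H\<^esub> w \<oplus>\<^bsub>H\<^esub> w = \<zero>\<^bsub>H\<^esub>" using w by (simp add: H.M.l_neg)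
      then show "\<exists>v\<in>carrier K. v \<oplus>\<^bsub>K\<^esub> w = \<zero>\<^bsub>K\<^esub>"
        using w by (intro bexI[of _ "(- 1) \<odot>\<^bsub>H\<^esub> w"]) (simp_all add: F_simps V0)
    qed (simp_all add: F0 F_simps H.a_ac)
  qed (use H.smult_one H.smult_assoc1 H.smult_l_distr
        in \<open>auto simp: cring_scalars H.smult_r_distr F_simps V0\<close>)
  \<comment> \<open>The additive inverse is defined by a choice within the carrier, so that the
    differences of \<open>K\<close> and \<open>H\<close> agree needs a proof; both are sums with a
    multiple by \<open>- 1\<close>.\<close>
  have diff: "v \<ominus>\<^bsub>K\<^esub> w = v \<ominus>\<^bsub>H\<^esub> w" if "v \<in> carrier K" "w \<in> carrier K" for v w
    using module_diff[OF mod that] that by (simp add: H.diff_conv)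
  show K: "hilbert_space K"
  proof (intro hilbert_space.intro mod hilbert_space_axioms.intro)
    fix s :: "nat \<Rightarrow> 'a"
    assume s: "\<forall>n. s n \<in> carrier K"
      and c: "\<forall>e>0. \<exists>N. \<forall>m\<ge>N. \<forall>n\<ge>N. ip_norm K (s m \<ominus>\<^bsub>K\<^esub> s n) < e"
    have sH: "s n \<in> carrier H" "F (s n) = \<zero>\<^bsub>V\<^esub>" for n using s by auto
    obtain l where l: "l \<in> carrier H" "(\<lambda>n. ip_norm H (s n \<ominus>\<^bsub>H\<^esub> l)) \<longlonglongrightarrow> 0"
      using H.complete[of s] c sH s by (auto simp: norm_K diff simp del: K_simps)
    \<comment> \<open>As \<open>F (s n)\<close> is zero, \<open>F\<close> sends the difference of
      \<open>s n\<close> and \<open>l\<close> to the negative of \<open>F l\<close>.\<close>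
    have "ip_norm V (F l) \<le> C * ip_norm H (s n \<ominus>\<^bsub>H\<^esub> l)" for n
    proof -
      have "F (s n \<ominus>\<^bsub>H\<^esub> l) = (- 1) \<odot>\<^bsub>V\<^esub> F l"
        using sH[of n] l by (simp add: H.diff_conv F_simps)
      then show ?thesis
        using C[of "s n \<ominus>\<^bsub>H\<^esub> l"] sH(1)[of n] l by (simp add: V.ip_norm_smult F_simps)
    qed
    moreover have "(\<lambda>n. C * ip_norm H (s n \<ominus>\<^bsub>H\<^esub> l)) \<longlonglongrightarrow> 0"
      using tendsto_mult_left[OF l(2), of C] by simp
    ultimately have "ip_norm V (F l) \<le> 0" by (intro LIMSEQ_le_const) auto
    then have "ip_norm V (F l) = 0" using V.ip_norm_nonneg[of "F l"] by linarith
    then have lK: "l \<in> carrier K" using V.ip_norm_zero_imp[of "F l"] l(1) by (simp add: F_simps)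
    show "\<exists>l\<in>carrier K. (\<lambda>n. ip_norm K (s n \<ominus>\<^bsub>K\<^esub> l)) \<longlonglongrightarrow> 0"
      using lK l(2) s by (intro bexI[of _ l]) (simp_all add: norm_K diff del: K_simps)
  next
    fix v w assume "v \<in> carrier K" "w \<in> carrier K"
    then show "ip K w v = conjugate (ip K v w)" using H.ip_commute[of v w] by simp
  qed (simp_all add: H.ip_add H.ip_smult H.ip_nonneg H.ip_definite)
  show "bounded_operator K H (\<lambda>w. w)"
    by (rule bounded_operatorI[where C = 1, OF K]) (simp_all add: norm_K)
qed

section \<open>Linear relations\<close>

text \<open>A pair \<open>(z, y)\<close> lies in the product if some \<open>x\<close> is related to
  \<open>y\<close> by \<open>A\<close> and to \<open>z\<close> by \<open>B\<close>. Once these two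
  pairs are parametrised, the only condition left is that their first components agree.\<close>

lemma range_space_relation_relcomp_converse:
  fixes X :: "('k::real_or_complex, 'x) inner_product_space"
    and Y :: "('k, 'y) inner_product_space"
    and Z :: "('k, 'z) inner_product_space"
  assumes X: "hilbert_space X" and Y: "hilbert_space Y" and Z: "hilbert_space Z"
    and A: "range_space_relation X Y A" and B: "range_space_relation X Z B"
  shows "range_space_relation Z Y (A \<circ>\<^sub>r B\<inverse>)"
proof -
  interpret X: hilbert_space X by fact
  obtain U :: "('k, 'x \<times> 'y) inner_product_space" and F
    where U: "hilbert_space U" and F: "bounded_operator U (hilbert_prod X Y) F"
      and A_eq: "A = F ` carrier U"
    using A unfolding range_space_relation_def by blast
  obtain V :: "('k, 'x \<times> 'z) inner_product_space" and G
    where V: "hilbert_space V" and G: "bounded_operator V (hilbert_prod X Z) G"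
      and B_eq: "B = G ` carrier V"
    using B unfolding range_space_relation_def by blast
  define P where "P = hilbert_prod U V"
  have P: "hilbert_space P"
    unfolding P_def by (rule hilbert_space_hilbert_prod[OF U V])
  have FP: "bounded_operator P (hilbert_prod X Y) (\<lambda>p. F (fst p))"
    unfolding P_def
    by (rule bounded_operator_comp[OF P[unfolded P_def] bounded_operator_fst[OF U V] F])
  have GP: "bounded_operator P (hilbert_prod X Z) (\<lambda>p. G (snd p))"
    unfolding P_def
    by (rule bounded_operator_comp[OF P[unfolded P_def] bounded_operator_snd[OF U V] G])
  note FX = bounded_operator_comp[OF P FP bounded_operator_fst[OF X Y]]
    and FY = bounded_operator_comp[OF P FP bounded_operator_snd[OF X Y]]
    and GX = bounded_operator_comp[OF P GP bounded_operator_fst[OF X Z]]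
    and GZ = bounded_operator_comp[OF P GP bounded_operator_snd[OF X Z]]
  \<comment> \<open>The kernel of \<open>D\<close> is the fibre product of \<open>U\<close> and
    \<open>V\<close> over \<open>X\<close>.\<close>
  define D where "D = (\<lambda>p. fst (F (fst p)) \<ominus>\<^bsub>X\<^esub> fst (G (snd p)))"
  have D: "bounded_operator P X D"
    unfolding D_def by (rule bounded_operator_diff[OF P X FX GX])
  define K where "K = P\<lparr>carrier := {p \<in> carrier P. D p = \<zero>\<^bsub>X\<^esub>}\<rparr>"
  note K = hilbert_space_kernel[OF P X D, folded K_def]
  have carrier_K: "(u, v) \<in> carrier K \<longleftrightarrow>
      u \<in> carrier U \<and> v \<in> carrier V \<and> fst (F u) = fst (G v)" for u v
  proof -
    have "fst (F u) \<ominus>\<^bsub>X\<^esub> fst (G v) = \<zero>\<^bsub>X\<^esub> \<longleftrightarrow> fst (F u) = fst (G v)"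
      if "u \<in> carrier U" "v \<in> carrier V"
      using bounded_operatorD(1)[OF F that(1)] bounded_operatorD(1)[OF G that(2)]
      by (simp add: hilbert_prod_simps mem_Times_iff X.diff_eq_zero_iff)
    then show ?thesis by (auto simp: K_def P_def D_def hilbert_prod_simps)
  qed
  \<comment> \<open>The two facts in \<open>K\<close> say that the kernel is a Hilbert space and
    that its inclusion in \<open>P\<close> is bounded; composing with the inclusion restricts the
    operator from \<open>P\<close> to the kernel.\<close>
  have "bounded_operator K (hilbert_prod Z Y) (\<lambda>p. (snd (G (snd p)), snd (F (fst p))))"
    by (rule bounded_operator_comp[OF K bounded_operator_Pair[OF P Z Y GZ FY]])
  \<comment> \<open>The carrier of \<open>K\<close> does not live in the type
    \<open>'z \<times> 'y\<close> that the definition prescribes;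
    \<open>range_space_relationI\<close> removes this obstacle and also yields linearity.\<close>
  then have "range_space_relation Z Y ((\<lambda>p. (snd (G (snd p)), snd (F (fst p)))) ` carrier K)"
    by (rule range_space_relationI[OF Z Y K(1)])
  also have "(\<lambda>p. (snd (G (snd p)), snd (F (fst p)))) ` carrier K = A \<circ>\<^sub>r B\<inverse>"
  proof (intro Set.set_eqI iffI)
    fix t assume "t \<in> (\<lambda>p. (snd (G (snd p)), snd (F (fst p)))) ` carrier K"
    then obtain u v where uv: "(u, v) \<in> carrier K" and t: "t = (snd (G v), snd (F u))" by auto
    \<comment> \<open>On \<open>carrier K\<close> the point \<open>fst (G v)\<close> equals
      \<open>fst (F u)\<close>; it is the middle element of the product.\<close>
    have "(fst (G v), snd (F u)) \<in> A"
      using uv unfolding carrier_K A_eq by (metis imageI prod.collapse)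
    moreover have "(fst (G v), snd (G v)) \<in> B"
      using uv unfolding carrier_K B_eq by simp
    ultimately show "t \<in> A \<circ>\<^sub>r B\<inverse>" unfolding t by blast
  next
    fix t assume "t \<in> A \<circ>\<^sub>r B\<inverse>"
    then obtain x y z where t: "t = (z, y)" and "(x, y) \<in> A" "(x, z) \<in> B" by auto
    obtain u where "u \<in> carrier U" "F u = (x, y)"
      using \<open>(x, y) \<in> A\<close> unfolding A_eq by force
    moreover obtain v where "v \<in> carrier V" "G v = (x, z)"
      using \<open>(x, z) \<in> B\<close> unfolding B_eq by force
    ultimately show "t \<in> (\<lambda>p. (snd (G (snd p)), snd (F (fst p)))) ` carrier K"
      by (intro image_eqI[of _ _ "(u, v)"]) (simp_all add: t carrier_K)
  qed
  finally show ?thesis .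
qed

section \<open>Componentwise rules for linear relations, and graphs\<close>

text \<open>The rule for differences matters most below: subtracting two pairs that share a
  component leaves a pair with a zero in that place.\<close>

lemma linear_relationD:
  assumes "hilbert_space X" "hilbert_space Y" and A: "linear_relation X Y A"
  shows "(x, y) \<in> A \<Longrightarrow> x \<in> carrier X" and "(x, y) \<in> A \<Longrightarrow> y \<in> carrier Y"
    and "(\<zero>\<^bsub>X\<^esub>, \<zero>\<^bsub>Y\<^esub>) \<in> A"
    and "(x, y) \<in> A \<Longrightarrow> (x', y') \<in> A \<Longrightarrow> (x \<oplus>\<^bsub>X\<^esub> x', y \<oplus>\<^bsub>Y\<^esub> y') \<in> A"
    and "(x, y) \<in> A \<Longrightarrow> (a \<odot>\<^bsub>X\<^esub> x, a \<odot>\<^bsub>Y\<^esub> y) \<in> A"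
    and "(x, y) \<in> A \<Longrightarrow> (x', y') \<in> A \<Longrightarrow> (x \<ominus>\<^bsub>X\<^esub> x', y \<ominus>\<^bsub>Y\<^esub> y') \<in> A"
proof -
  interpret X: hilbert_space X by fact
  interpret Y: hilbert_space Y by fact
  interpret P: hilbert_space "hilbert_prod X Y" by (rule hilbert_space_hilbert_prod) fact+
  have sub: "submodule A scalars (hilbert_prod X Y)"
    using A by (simp add: linear_relation_def)
  show x: "x \<in> carrier X" if "(x, y) \<in> A" for x y
    using P.submoduleE(1)[OF sub] that by (auto simp: hilbert_prod_simps)
  show y: "y \<in> carrier Y" if "(x, y) \<in> A" for x y
    using P.submoduleE(1)[OF sub] that by (auto simp: hilbert_prod_simps)
  show add: "(x \<oplus>\<^bsub>X\<^esub> x', y \<oplus>\<^bsub>Y\<^esub> y') \<in> A" if "(x, y) \<in> A" "(x', y') \<in> A" for x y x' y'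
    using P.submoduleE(5)[OF sub that] by (simp add: hilbert_prod_simps)
  show smult: "(a \<odot>\<^bsub>X\<^esub> x, a \<odot>\<^bsub>Y\<^esub> y) \<in> A" if "(x, y) \<in> A" for a x y
    using P.submoduleE(4)[OF sub _ that, of a] by (simp add: hilbert_prod_simps)
  show "(x \<ominus>\<^bsub>X\<^esub> x', y \<ominus>\<^bsub>Y\<^esub> y') \<in> A" if "(x, y) \<in> A" "(x', y') \<in> A"
    using add[OF that(1) smult[OF that(2), of "- 1"]] x y that
    by (simp add: X.diff_conv Y.diff_conv)
  \<comment> \<open>\<open>submoduleE(2)\<close> only gives nonemptiness; the zero pair is then the
    multiple by \<open>0\<close> of any element.\<close>
  obtain x y where "(x, y) \<in> A" using P.submoduleE(2)[OF sub] by fast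
  then show "(\<zero>\<^bsub>X\<^esub>, \<zero>\<^bsub>Y\<^esub>) \<in> A"
    using smult[of x y 0] x y X.smult_l_null[of x] Y.smult_l_null[of y] by simp
qed

text \<open>Two values over the same point differ by an element of \<open>rel_mul X A\<close>, so
  the relation is single-valued.\<close>

lemma linear_relation_graphI:
  assumes X: "hilbert_space X" and Y: "hilbert_space Y" and A: "linear_relation X Y A"
    and mul: "rel_mul X A \<subseteq> {\<zero>\<^bsub>Y\<^esub>}"
  shows "\<exists>D f. linear_operator X Y D f \<and> A = {(x, f x) | x. x \<in> D}"
proof -
  interpret X: hilbert_space X by fact
  interpret Y: hilbert_space Y by fact
  note A = linear_relationD[OF X Y A]
  have uniq: "y = y'" if "(x, y) \<in> A" "(x, y') \<in> A" for x y y'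
  proof -
    have "(\<zero>\<^bsub>X\<^esub>, y \<ominus>\<^bsub>Y\<^esub> y') \<in> A" 
      using A(6)[OF that] A(1)[OF that(1)] X.diff_eq_zero_iff[of x x] by simp
    then show ?thesis using mul A(2)[OF that(1)] A(2)[OF that(2)] Y.diff_eq_zero_iff[of y y']
      by (auto simp: rel_mul_def)
  qed
  define f where "f = (\<lambda>x. THE y. (x, y) \<in> A)"
  have f: "f x = y" if "(x, y) \<in> A" for x y
    unfolding f_def using that uniq by (intro the_equality) blast+
  have f': "(x, f x) \<in> A" if "x \<in> Domain A" for x
    using that f by auto
  have "submodule (Domain A) scalars X"
  proof (rule X.submoduleI)
    fix x assume "x \<in> Domain A"
    then obtain y where xy: "(x, y) \<in> A" by blast
    then have "(- 1) \<odot>\<^bsub>X\<^esub> x = \<ominus>\<^bsub>X\<^esub> x"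
      using A(1) X.smult_l_minus[of 1 x] X.smult_one[of x] by simp
    then show "\<ominus>\<^bsub>X\<^esub> x \<in> Domain A" using A(5)[OF xy, of "- 1"] by auto
  next
    show "Domain A \<subseteq> carrier X" using A(1) by blast
    show "\<zero>\<^bsub>X\<^esub> \<in> Domain A" using A(3) by blast
    show "x \<oplus>\<^bsub>X\<^esub> x' \<in> Domain A" if "x \<in> Domain A" "x' \<in> Domain A" for x x'
      using A(4)[OF f' f'] that by blast
    show "a \<odot>\<^bsub>X\<^esub> x \<in> Domain A" if "x \<in> Domain A" for a x
      using A(5)[OF f'] that by blast
  qed
  then have "linear_operator X Y (Domain A) f"
    unfolding linear_operator_def
    using A(2)[OF f'] f[OF A(4)[OF f' f']] f[OF A(5)[OF f']] by simp
  moreover have "A = {(x, f x) | x. x \<in> Domain A}"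
  proof (intro Set.set_eqI iffI)
    fix p assume "p \<in> A"
    then show "p \<in> {(x, f x) | x. x \<in> Domain A}" using f by (cases p) blast
  qed (use f' in blast)
  ultimately show ?thesis by blast
qed

theorem corollary2p7:
  fixes X :: "('k::real_or_complex, 'x) inner_product_space"
    and Y :: "('k, 'y) inner_product_space"
    and Z :: "('k, 'z) inner_product_space"
    and A :: "('x \<times> 'y) set"
    and B :: "('x \<times> 'z) set"
  assumes "hilbert_space X" and "hilbert_space Y" and "hilbert_space Z"
    and "range_space_relation X Y A"
    and "range_space_relation X Z B"
  shows "(range_space_operator Z Y (A \<circ>\<^sub>r B\<inverse>) \<and> A = (A \<circ>\<^sub>r B\<inverse>) \<circ>\<^sub>r B) \<longleftrightarrow>
    (Domain A \<subseteq> Domain B \<and> rel_ker Z B \<subseteq> rel_ker Y A \<and> rel_mul X A = {\<zero>\<^bsub>Y\<^esub>})"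
proof -
  note X = assms(1) and Y = assms(2) and Z = assms(3)
  interpret X: hilbert_space X by fact
  interpret Y: hilbert_space Y by fact
  have T: "range_space_relation Z Y (A \<circ>\<^sub>r B\<inverse>)"
    by (rule range_space_relation_relcomp_converse) fact+
  have lin: "linear_relation X Y A" "linear_relation X Z B" "linear_relation Z Y (A \<circ>\<^sub>r B\<inverse>)"
    using T assms(4,5) by (simp_all add: range_space_relation_def)
  note A = linear_relationD[OF X Y lin(1)] and B = linear_relationD[OF X Z lin(2)]
  show ?thesis
  proof (intro iffI conjI)
    assume "range_space_operator Z Y (A \<circ>\<^sub>r B\<inverse>) \<and> A = (A \<circ>\<^sub>r B\<inverse>) \<circ>\<^sub>r B"
    then obtain D f where T_eq: "A \<circ>\<^sub>r B\<inverse> = {(z, f z) | z. z \<in> D}"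
      and A_eq: "A = (A \<circ>\<^sub>r B\<inverse>) \<circ>\<^sub>r B"
      unfolding range_space_operator_def by blast
    \<comment> \<open>This pair serves twice: it continues any pair \<open>(x, \<zero>)\<close> of
      \<open>B\<close> to a pair \<open>(x, \<zero>)\<close> of \<open>A\<close>, and it fixes the
      value of the operator at zero.\<close>
    have T0: "(\<zero>\<^bsub>Z\<^esub>, \<zero>\<^bsub>Y\<^esub>) \<in> A \<circ>\<^sub>r B\<inverse>" using A(3) B(3) by blast
    show "Domain A \<subseteq> Domain B" using A_eq by blast
    show "rel_ker Z B \<subseteq> rel_ker Y A"
      unfolding rel_ker_def using A_eq T0 by blast
    \<comment> \<open>Since \<open>B\<close> relates zero to zero, every element of
      \<open>rel_mul X A\<close> is a value of the product at zero.\<close>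
    have "y = \<zero>\<^bsub>Y\<^esub>" if "(\<zero>\<^bsub>X\<^esub>, y) \<in> A" for y
    proof -
      have "(\<zero>\<^bsub>Z\<^esub>, y) \<in> A \<circ>\<^sub>r B\<inverse>" using that B(3) by blast
      then show ?thesis using T0 unfolding T_eq by auto
    qed
    then show "rel_mul X A = {\<zero>\<^bsub>Y\<^esub>}" using A(3) unfolding rel_mul_def by blast
  next
    assume r: "Domain A \<subseteq> Domain B \<and> rel_ker Z B \<subseteq> rel_ker Y A \<and> rel_mul X A = {\<zero>\<^bsub>Y\<^esub>}"
    then have ker: "(x, \<zero>\<^bsub>Y\<^esub>) \<in> A" if "(x, \<zero>\<^bsub>Z\<^esub>) \<in> B" for x
      using that by (auto simp: rel_ker_def)
    \<comment> \<open>Here \<open>y\<close> is an arbitrary value of the product at zero, reached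
      through \<open>x\<close>. The kernel inclusion puts \<open>(x, \<zero>)\<close> in
      \<open>A\<close> as well, and subtracting it from \<open>(x, y)\<close> leaves
      \<open>y\<close> in \<open>rel_mul X A\<close>.\<close>
    have "y = \<zero>\<^bsub>Y\<^esub>" if "(x, \<zero>\<^bsub>Z\<^esub>) \<in> B" "(x, y) \<in> A" for x y
    proof -
      have "(\<zero>\<^bsub>X\<^esub>, y) \<in> A"
        using A(6)[OF that(2) ker[OF that(1)]] A(1,2)[OF that(2)]
        X.diff_eq_zero_iff[of x x]
        by (simp add: Y.diff_conv Y.smult_r_null[of "- 1", simplified])
      then show ?thesis using r by (auto simp: rel_mul_def)
    qed
    then have "rel_mul Z (A \<circ>\<^sub>r B\<inverse>) \<subseteq> {\<zero>\<^bsub>Y\<^esub>}" unfolding rel_mul_def by blast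
    then show "range_space_operator Z Y (A \<circ>\<^sub>r B\<inverse>)"
      using T linear_relation_graphI[OF Z Y lin(3)] by (simp add: range_space_operator_def)
    show "A = (A \<circ>\<^sub>r B\<inverse>) \<circ>\<^sub>r B"
    proof
      \<comment> \<open>For \<open>(x, y)\<close> in \<open>A\<close>, any \<open>z\<close> related
        to \<open>x\<close> by \<open>B\<close> will do: the way back from \<open>z\<close> may pass
        through \<open>x\<close> itself.\<close>
      have "Domain A \<subseteq> Domain B" using r by blast
      then show "A \<subseteq> (A \<circ>\<^sub>r B\<inverse>) \<circ>\<^sub>r B" by fast
      \<comment> \<open>Both \<open>x\<close> and \<open>x'\<close> are related to \<open>z\<close>
        by \<open>B\<close>, so they differ by an element of the kernel of \<open>B\<close>, hence
        of \<open>A\<close>. Adding that element to \<open>x'\<close> moves the first component to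
        \<open>x\<close> and leaves \<open>y\<close> unchanged.\<close>
      have "(x, y) \<in> A" if xz: "(x, z) \<in> B" and x'z: "(x', z) \<in> B" and x'y: "(x', y) \<in> A"
        for x x' y z
      proof -
        interpret Z: hilbert_space Z by fact
        have "(x \<ominus>\<^bsub>X\<^esub> x', \<zero>\<^bsub>Z\<^esub>) \<in> B"
          using B(6)[OF xz x'z] B(2)[OF xz] Z.diff_eq_zero_iff[of z z] by simp
        then have "(x' \<oplus>\<^bsub>X\<^esub> (x \<ominus>\<^bsub>X\<^esub> x'), y \<oplus>\<^bsub>Y\<^esub> \<zero>\<^bsub>Y\<^esub>) \<in> A"
          using A(4)[OF x'y] ker by blast
        then show ?thesis
          using X.diff_add_self[of x' x] B(1)[OF xz] A(1,2)[OF x'y] by simp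
      qed
      then show "(A \<circ>\<^sub>r B\<inverse>) \<circ>\<^sub>r B \<subseteq> A" by blast
    qed
  qed
qed

end
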